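(* Let $k\ge 3$ and $1\le \ell\le k-1$ be integers, and let $F$ be a $k$-graph. If $\pi_\ell(F)=0$, then $F$ is layered.
   Context: A $k$-graph is a finite $k$-uniform hypergraph: a finite vertex set $V(F)$ together with a set $E(F)$ of $k$-element subsets of $V(F)$ called edges. A $k$-graph $H$ is $F$-free if it contains no (not necessarily induced) subhypergraph isomorphic to $F$. Layered: for a function $f:V(F)\to\mathbb N$ and $e\in E(F)$, let $f(e)$ denote the multiset $\{f(v):v\in e\}$. The function $f$ is a layered function of $F$ if (A1) each edge has exactly one vertex whose label is the maximum within the edge; and (A2) if $e,e'\in E(F)$ satisfy $\max f(e)=\max f(e')$, then $f(e)=f(e')$ as multisets. A $k$-graph is layered if it has a layered function. $\ell$-degree Turán density: for a $k$-graph $H$ and $S\subseteq V(H)$, $d_H(S)$ is the number of edges of $H$ containing $S$. The minimum $\ell$-degree $\delta_\ell(H)$ is the minimum of $d_H(S)$ over all $\ell$-subsets $S$ of $V(H)$. The $\ell$-degree Turán number $\mathrm{ex}_\ell(n,F)$ is the maximum of $\delta_\ell(H)$ over all $n$-vertex $F$-free $k$-graphs $H$, and $$\pi_\ell(F)=\lim_{n\to\infty}\frac{\mathrm{ex}_\ell(n,F)}{\binom{n}{k-\ell}};$$ it is known that this limit always exists. *)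

theory Defs
  imports Complex_Main "HOL-Library.Multiset"
begin

record 'a hypergraph =
  verts :: "'a set"
  edges :: "'a set set"

definition kgraph :: "nat \<Rightarrow> 'a hypergraph \<Rightarrow> bool" where
  "kgraph k H \<longleftrightarrow> finite (verts H) \<and> (\<forall>e\<in>edges H. e \<subseteq> verts H \<and> card e = k)"

definition subhypergraph :: "'a hypergraph \<Rightarrow> 'a hypergraph \<Rightarrow> bool" where
  "subhypergraph G H \<longleftrightarrow>
     verts G \<subseteq> verts H \<and> edges G \<subseteq> edges H \<and> (\<forall>e\<in>edges G. e \<subseteq> verts G)"

definition isomorphic :: "'a hypergraph \<Rightarrow> 'b hypergraph \<Rightarrow> bool" where
  "isomorphic F G \<longleftrightarrow>
     (\<exists>\<phi>. bij_betw \<phi> (verts F) (verts G) \<and> edges G = (\<lambda>e. \<phi> ` e) ` edges F)"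

definition hfree :: "'a hypergraph \<Rightarrow> 'b hypergraph \<Rightarrow> bool" where
  "hfree F H \<longleftrightarrow> \<not> (\<exists>G. subhypergraph G H \<and> isomorphic F G)"

definition label_mset :: "('a \<Rightarrow> nat) \<Rightarrow> 'a set \<Rightarrow> nat multiset" where
  "label_mset f e = image_mset f (mset_set e)"

definition layered_function :: "'a hypergraph \<Rightarrow> ('a \<Rightarrow> nat) \<Rightarrow> bool" where
  "layered_function F f \<longleftrightarrow>
     (\<forall>e\<in>edges F. \<exists>!v. v \<in> e \<and> f v = Max (f ` e)) \<and>
     (\<forall>e\<in>edges F. \<forall>e'\<in>edges F.
        Max (f ` e) = Max (f ` e') \<longrightarrow> label_mset f e = label_mset f e')"

definition layered :: "'a hypergraph \<Rightarrow> bool" where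
  "layered F \<longleftrightarrow> (\<exists>f. layered_function F f)"

definition deg :: "'a hypergraph \<Rightarrow> 'a set \<Rightarrow> nat" where
  "deg H S = card {e \<in> edges H. S \<subseteq> e}"

definition min_deg :: "nat \<Rightarrow> 'a hypergraph \<Rightarrow> nat" where
  "min_deg l H = Min (deg H ` {S. S \<subseteq> verts H \<and> card S = l})"

text \<open>
  Up to isomorphism every finite hypergraph has its vertices in \<^typ>\<open>nat\<close>, so host graphs
  range over that type. The maximum is over the empty set only if \<open>F\<close> has no edges
  and at most \<open>n\<close> vertices; the minimum in \<open>min_deg\<close> is over the empty set only
  if \<open>H\<close> has fewer than \<open>l\<close> vertices.
\<close>

definition ex_deg :: "nat \<Rightarrow> nat \<Rightarrow> nat \<Rightarrow> 'a hypergraph \<Rightarrow> nat" where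
  "ex_deg k l n F =
     Max {min_deg l H | H :: nat hypergraph. kgraph k H \<and> card (verts H) = n \<and> hfree F H}"

text \<open>
  The Turan density is a limit, so it is given as a relation between \<open>F\<close> and its
  value, in the style of \<open>sums\<close>: \<open>has_turan_density k l F x\<close> says that the
  limit defining the \<open>l\<close>-degree density of \<open>F\<close> is \<open>x\<close>.
\<close>

definition has_turan_density :: "nat \<Rightarrow> nat \<Rightarrow> 'a hypergraph \<Rightarrow> real \<Rightarrow> bool" where
  "has_turan_density k l F x \<longleftrightarrow>
     (\<lambda>n. real (ex_deg k l n F) / real (n choose (k - l))) \<longlonglongrightarrow> x"

end

theory Submission
  imports Defs "HOL-Library.FuncSet"
begin

text \<open>
  Put \<open>q = k - 1\<close> and give every vertex of a host graph one of finitely many types; a \<open>k\<close>-set is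
  an edge if the type of one of its vertices, the top, is the value of a fixed operation \<open>join\<close> at
  the types of the other \<open>q\<close> vertices in some order. Every \<open>q\<close>-set then extends to linearly many
  edges, so all \<open>l\<close>-degrees have order \<open>n\<^sup>k\<^sup>-\<^sup>l\<close>. A type is a function of pairs \<open>(u, w)\<close> of words over
  \<open>{0, \<dots>, q - 1}\<close>. The word \<open>u\<close> is an address: the value of the top at \<open>(i # u, w)\<close> is the value of
  its \<open>i\<close>-th child at \<open>(u, w)\<close>, so that the top's type cut off at depth \<open>j + 1\<close> determines the
  types of the children cut off at depth \<open>j\<close>. The word \<open>w\<close> prevents short directed cycles: following
  children as prescribed by \<open>w\<close> raises a counter modulo \<open>L + 1\<close>.

  If the host contained \<open>F\<close>, then among the partitions of \<open>V(F)\<close> by types cut off at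
  depths \<open>0, \<dots>, |V(F)|\<close>, each refining the previous one, two consecutive partitions would agree.
  For that depth, the class of the top of an edge determines the classes of the other vertices, and
  as there are no short cycles, the classes can be numbered so that tops are larger
  than their children. This numbering is a layered function.
\<close>

section \<open>Types of vertices and the join operation\<close>

text \<open>The bounds keep the set of types finite. \<open>M\<close> will be the number of vertices
  of \<open>F\<close>, which leaves room for one letter beyond the stable depth; \<open>L\<close>
  will be its square, a bound on the length of the cycles to be excluded.\<close>

definition coords :: "nat \<Rightarrow> nat \<Rightarrow> nat \<Rightarrow> (nat list \<times> nat list) set" where
  "coords q M L = {u. set u \<subseteq> {..<q} \<and> length u \<le> M} \<times> {w. w \<noteq> [] \<and> set w \<subseteq> {..<q} \<and> length w \<le> L}"

definition types :: "nat \<Rightarrow> nat \<Rightarrow> nat \<Rightarrow> (nat list \<times> nat list \<Rightarrow> nat) set" where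
  "types q M L = coords q M L \<rightarrow>\<^sub>E {..L}"

text \<open>Rotating \<open>w\<close> instead of dropping its first letter brings back the same
  coordinate after \<open>length w\<close> steps, so that a closed walk can be compared with
  itself.\<close>

definition join :: "nat \<Rightarrow> nat \<Rightarrow> nat \<Rightarrow> (nat \<Rightarrow> nat list \<times> nat list \<Rightarrow> nat) \<Rightarrow> nat list \<times> nat list \<Rightarrow> nat" where
  "join q M L y = restrict (\<lambda>(u, w). if u = [] then Suc (y (hd w) ([], rotate1 w)) mod Suc L
     else y (hd u) (tl u, w)) (coords q M L)"

lemma finite_types: "finite (types q M L)"
  unfolding types_def coords_def
  by (intro finite_PiE finite_cartesian_product) (auto intro: finite_lists_length_le)

lemma types_nonempty: "types q M L \<noteq> {}"
  unfolding types_def by (auto simp: PiE_eq_empty_iff)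

lemma join_in_types:
  assumes "\<And>i. i < q \<Longrightarrow> y i \<in> types q M L"
  shows "join q M L y \<in> types q M L"
  unfolding types_def
proof (rule PiE_I)
  fix p assume p: "p \<in> coords q M L"
  obtain u w where uw: "p = (u, w)" by fastforce
  show "join q M L y p \<in> {..L}"
  proof (cases u)
    case Nil
    have "Suc n mod Suc L \<le> L" for n
      using mod_less_divisor[of "Suc L" "Suc n"] by linarith
    then show ?thesis using Nil p uw by (simp add: join_def)
  next
    case (Cons i u')
    then have "i < q" "(u', w) \<in> coords q M L" using p uw by (auto simp: coords_def)
    then have "y i (u', w) \<in> {..L}" using assms[of i] by (auto simp: types_def)
    then show ?thesis using Cons p uw by (simp add: join_def)
  qed
qed (simp add: join_def)

lemma join_child:
  assumes "(i # u, w) \<in> coords q M L"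
  shows "join q M L y (i # u, w) = y i (u, w)"
  using assms by (simp add: join_def)

lemma join_cong:
  assumes "\<And>i. i < q \<Longrightarrow> y i = y' i"
  shows "join q M L y = join q M L y'"
proof
  fix p :: "nat list \<times> nat list"
  obtain u w where p: "p = (u, w)" by fastforce
  show "join q M L y p = join q M L y' p"
  proof (cases "p \<in> coords q M L")
    case True
    then have "w \<noteq> []" "hd w < q" "u \<noteq> [] \<Longrightarrow> hd u < q"
      using p by (auto simp: coords_def subset_iff)
    then show ?thesis using p assms by (simp add: join_def)
  qed (simp add: join_def)
qed

lemma join_root:
  assumes "([], w) \<in> coords q M L"
  shows "join q M L y ([], w) = Suc (y (hd w) ([], rotate1 w)) mod Suc L"
  using assms by (simp add: join_def)

text \<open>Reading off the coordinates whose second word lists the child positions used along the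
  walk, each step adds 1 modulo \<open>L + 1\<close>.\<close>
lemma no_short_cycle:
  fixes z :: "nat \<Rightarrow> nat list \<Rightarrow> nat"
  assumes step: "\<And>j w. \<lbrakk>j < n; set w \<subseteq> {..<q}; length w \<le> L; w \<noteq> []; hd w = \<iota> j\<rbrakk>
      \<Longrightarrow> z (Suc j) w = Suc (z j (rotate1 w)) mod Suc L"
    and \<iota>: "\<And>j. j < n \<Longrightarrow> \<iota> j < q" and n: "0 < n" "n \<le> L" and closed: "z n = z 0"
  shows False
proof -
  \<comment> \<open>The walk ascends from child to top, but the counters are unfolded from the top
    down; hence the reversed order.\<close>
  define w where "w = map (\<lambda>j. \<iota> (n - 1 - j)) [0..<n]"
  have len: "length w = n" by (simp add: w_def)
  have setw: "set w \<subseteq> {..<q}" using \<iota> n by (auto simp: w_def)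
  have "z n w mod Suc L = (z (n - j) (rotate j w) + j) mod Suc L" if "j \<le> n" for j
    using that
  proof (induction j)
    case (Suc j)
    let ?r = "rotate j w"
    have "hd ?r = w ! (j mod length w)"
      using len n by (intro hd_rotate_conv_nth) auto
    then have hd: "hd ?r = \<iota> (n - Suc j)" using Suc.prems len by (simp add: w_def)
    have "z (Suc (n - Suc j)) ?r = Suc (z (n - Suc j) (rotate1 ?r)) mod Suc L"
      using Suc.prems len setw n hd by (intro step) auto
    then have "z (n - j) ?r = Suc (z (n - Suc j) (rotate (Suc j) w)) mod Suc L"
      using Suc.prems by (simp add: Suc_diff_Suc)
    then show ?case using Suc by (simp add: mod_simps)
  qed simp
  \<comment> \<open>After \<open>n\<close> rotations \<open>w\<close> is back, and
    \<open>z n = z 0\<close>, yet the counter has moved by \<open>n\<close>, which lies strictly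
    between 0 and \<open>Suc L\<close>.\<close>
  from this[of n] have "z 0 w mod Suc L = (z 0 w + n) mod Suc L"
    using len closed rotate_length01 by (simp add: rotate_id)
  then have "Suc L dvd n"
    by (metis add_diff_cancel_left' le_add1 mod_eq_dvd_iff_nat)
  then show False using n by (auto dest: dvd_imp_le)
qed

section \<open>From typed vertices to a layered function\<close>

text \<open>Pigeonhole: starting from at least one class, strict growth at each of
  \<open>card V\<close> refinements would give more classes than \<open>V\<close> has
  elements.\<close>

lemma stable_truncation:
  fixes \<tau> :: "nat \<Rightarrow> 'a \<Rightarrow> 'b"
  assumes fin: "finite V" and ne: "V \<noteq> {}"
    and coarser: "\<And>j. \<exists>p. \<forall>v\<in>V. \<tau> j v = p (\<tau> (Suc j) v)"
  obtains j where "j < card V"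
    "\<And>v v'. \<lbrakk>v \<in> V; v' \<in> V; \<tau> j v = \<tau> j v'\<rbrakk> \<Longrightarrow> \<tau> (Suc j) v = \<tau> (Suc j) v'"
proof -
  have "\<exists>j<card V. \<forall>v\<in>V. \<forall>v'\<in>V. \<tau> j v = \<tau> j v' \<longrightarrow> \<tau> (Suc j) v = \<tau> (Suc j) v'"
  proof (rule ccontr)
    assume contra: "\<not> ?thesis"
    have "Suc j \<le> card (\<tau> j ` V)" if "j \<le> card V" for j
      using that
    proof (induction j)
      case 0
      then show ?case using fin ne by (simp add: Suc_le_eq card_gt_0_iff)
    next
      case (Suc j)
      obtain p where p: "\<forall>v\<in>V. \<tau> j v = p (\<tau> (Suc j) v)" using coarser by blast
      then have im: "\<tau> j ` V = p ` \<tau> (Suc j) ` V" by (auto simp: image_image)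
      \<comment> \<open>\<open>p\<close> maps the finer classes onto the coarser ones; if it were
        injective, the two partitions would agree.\<close>
      have "\<not> inj_on p (\<tau> (Suc j) ` V)"
      proof
        assume "inj_on p (\<tau> (Suc j) ` V)"
        then have "\<forall>v\<in>V. \<forall>v'\<in>V. \<tau> j v = \<tau> j v' \<longrightarrow> \<tau> (Suc j) v = \<tau> (Suc j) v'"
          using p by (auto dest: inj_onD)
        then show False using contra Suc.prems by (meson Suc_le_lessD)
      qed
      then have "card (\<tau> j ` V) < card (\<tau> (Suc j) ` V)"
        unfolding im using fin
        by (metis card_image_le eq_card_imp_inj_on finite_imageI le_neq_implies_less)
      then show ?case using Suc by linarith
    qed
    from this[of "card V"] show False using card_image_le[OF fin, of "\<tau> (card V)"] by simp
  qed
  then show ?thesis using that by blast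
qed

text \<open>The number \<open>d\<close> of proper ancestors under the transitive closure increases
  strictly along \<open>R\<close>. Ties are broken by an enumeration \<open>idx\<close> below
  \<open>N\<close>, so \<open>d * N + idx\<close> orders lexicographically.\<close>

lemma acyclic_injective_ranking:
  assumes "finite A" and "R \<subseteq> A \<times> A" and "acyclic R"
  obtains h :: "'b \<Rightarrow> nat" where "inj_on h A" "\<And>a b. (a, b) \<in> R \<Longrightarrow> h a < h b"
proof -
  obtain idx :: "'b \<Rightarrow> nat" and N where idx: "idx ` A = {i. i < N}" "inj_on idx A"
    using finite_imp_inj_to_nat_seg[OF assms(1)] by blast
  define d where "d b = card {a. (a, b) \<in> R\<^sup>+}" for b
  have fin: "finite {a. (a, b) \<in> R\<^sup>+}" for b
    using trancl_subset_Sigma[OF assms(2)] by (intro finite_subset[OF _ assms(1)]) auto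
  have d: "d a < d b" if "(a, b) \<in> R" for a b
    unfolding d_def
  proof (rule psubset_card_mono[OF fin])
    have "(a, a) \<notin> R\<^sup>+" using assms(3) by (simp add: acyclic_def)
    then show "{c. (c, a) \<in> R\<^sup>+} \<subset> {c. (c, b) \<in> R\<^sup>+}"
      using that by (auto intro: trancl_into_trancl)
  qed
  let ?h = "\<lambda>a. d a * N + idx a"
  have lt: "idx a < N" if "a \<in> A" for a using idx(1) that by blast
  have "inj_on ?h A"
  proof (rule inj_onI)
    fix a b assume ab: "a \<in> A" "b \<in> A" "?h a = ?h b"
    then have "(idx a + d a * N) mod N = (idx b + d b * N) mod N" by (simp add: add.commute)
    then have "idx a = idx b" using lt ab(1,2) by (simp only: mod_mult_self1 mod_less)
    then show "a = b" using idx(2) ab by (auto dest: inj_onD)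
  qed
  moreover have "?h a < ?h b" if "(a, b) \<in> R" for a b
  proof -
    have "Suc (d a) * N \<le> d b * N" using d[OF that] by (intro mult_le_mono1) simp
    moreover have "idx a < N" using that assms(2) lt by blast
    ultimately show ?thesis by simp
  qed
  ultimately show ?thesis using that by blast
qed

text \<open>In the application, \<open>x v\<close> is the type of the image of \<open>v\<close> in
  the host.\<close>

lemma layered_if_typed:
  assumes fin: "finite (verts F)" and sub: "\<And>e. e \<in> edges F \<Longrightarrow> e \<subseteq> verts F"
    and L: "L = card (verts F) * card (verts F)"
    and edge: "\<And>e. e \<in> edges F \<Longrightarrow> \<exists>t g. e = insert t (g ` {..<q}) \<and> card e = Suc q \<and>
        x t = join q (card (verts F)) L (\<lambda>i. x (g i))"
  shows "layered F"
proof (cases "verts F = {}")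
  case True
  have "edges F = {}"
  proof (rule ccontr)
    assume "edges F \<noteq> {}"
    then obtain e where "e \<in> edges F" by blast
    then show False using edge[of e] sub[of e] True by auto
  qed
  then show ?thesis by (simp add: layered_def layered_function_def)
next
  case False
  define V where "V = verts F"
  define M where "M = card V"
  define D where "D = coords q M L"
  \<comment> \<open>Only the address is cut off. All counter coordinates \<open>([], w)\<close>
    survive even at depth 0, so cycles can be excluded whatever the stable depth is.\<close>
  define \<tau> where "\<tau> j v = restrict (x v) {p \<in> D. length (fst p) \<le> j}" for j v
  from edge obtain t g where tg: "\<And>e. e \<in> edges F \<Longrightarrow> e = insert (t e) (g e ` {..<q})"
    "\<And>e. e \<in> edges F \<Longrightarrow> card e = Suc q"
    "\<And>e. e \<in> edges F \<Longrightarrow> x (t e) = join q M L (\<lambda>i. x (g e i))"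
    unfolding M_def V_def by metis
  have tV: "t e \<in> V" if "e \<in> edges F" for e using that tg(1) sub V_def by blast
  have gV: "g e i \<in> V" if "e \<in> edges F" "i < q" for e i
    using that tg(1)[of e] sub[of e] V_def by blast
  have "\<exists>p. \<forall>v\<in>V. \<tau> j v = p (\<tau> (Suc j) v)" for j
    by (rule exI[of _ "\<lambda>y. restrict y {p \<in> D. length (fst p) \<le> j}"]) (auto simp: \<tau>_def fun_eq_iff restrict_def)
  then obtain J where J: "J < M"
    "\<And>v v'. \<lbrakk>v \<in> V; v' \<in> V; \<tau> J v = \<tau> J v'\<rbrakk> \<Longrightarrow> \<tau> (Suc J) v = \<tau> (Suc J) v'"
    using stable_truncation[of V \<tau>] fin False unfolding V_def M_def by metis
  have children: "\<tau> J (g e i) = \<tau> J (g e' i)"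
    if e: "e \<in> edges F" "e' \<in> edges F" "i < q" "\<tau> J (t e) = \<tau> J (t e')" for e e' i
  proof
    fix p :: "nat list \<times> nat list"
    obtain u w where p: "p = (u, w)" by fastforce
    show "\<tau> J (g e i) p = \<tau> J (g e' i) p"
    proof (cases "p \<in> D \<and> length u \<le> J")
      case True
      \<comment> \<open>\<open>J < M\<close> keeps the address within its bound after
        \<open>i\<close> is prepended.\<close>
      then have in_D: "(i # u, w) \<in> D" "length (i # u) \<le> Suc J"
        using p e(3) J(1) by (auto simp: D_def coords_def)
      have "\<tau> (Suc J) (t e) = \<tau> (Suc J) (t e')" using J(2) tV e by blast
      then have "\<tau> (Suc J) (t e) (i # u, w) = \<tau> (Suc J) (t e') (i # u, w)" by simp
      then have "x (t e) (i # u, w) = x (t e') (i # u, w)" using in_D by (simp add: \<tau>_def)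
      then have "x (g e i) (u, w) = x (g e' i) (u, w)"
        using in_D(1) e(1,2) by (simp add: tg(3) join_child D_def)
      then show ?thesis using p True by (simp add: \<tau>_def)
    qed (auto simp: \<tau>_def p)
  qed
  \<comment> \<open>Consecutive steps of a cycle in \<open>R\<close> may come from edges that share
    a class but no vertex. The counters depend on the class alone, so \<open>no_short_cycle\<close>
    still applies.\<close>
  define R where "R = {(\<tau> J (g e i), \<tau> J (t e)) | e i. e \<in> edges F \<and> i < q}"
  have finV: "finite (\<tau> J ` V)" using fin V_def by simp
  have R_sub: "R \<subseteq> \<tau> J ` V \<times> \<tau> J ` V" using tV gV by (auto simp: R_def)
  then have finR: "finite R" using finV by (meson finite_SigmaI finite_subset)
  have "card R \<le> card (\<tau> J ` V) * card (\<tau> J ` V)"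
    using card_mono[OF _ R_sub] finV by (simp add: card_cartesian_product)
  also have "\<dots> \<le> L" using fin by (simp add: L V_def card_image_le mult_le_mono)
  finally have cardR: "card R \<le> L" .
  have "acyclic R"
  proof (rule acyclicI, rule allI, rule notI)
    fix a assume "(a, a) \<in> R\<^sup>+"
    \<comment> \<open>In a finite relation, \<open>card R\<close> steps suffice for any pair of the
      transitive closure; this dictates the size of \<open>L\<close>.\<close>
    then obtain n where n: "0 < n" "n \<le> L" "(a, a) \<in> R ^^ n"
      using trancl_finite_eq_relpow[OF finR] cardR by auto
    then obtain f where f: "f 0 = a" "f n = a" "\<And>j. j < n \<Longrightarrow> (f j, f (Suc j)) \<in> R"
      by (auto simp: relpow_fun_conv)
    have "\<exists>e i. e \<in> edges F \<and> i < q \<and> f j = \<tau> J (g e i) \<and> f (Suc j) = \<tau> J (t e)" if "j < n" for j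
      using f(3)[OF that] by (auto simp: R_def)
    then obtain e \<iota> where e: "\<And>j. j < n \<Longrightarrow> e j \<in> edges F \<and> \<iota> j < q \<and>
        f j = \<tau> J (g (e j) (\<iota> j)) \<and> f (Suc j) = \<tau> J (t (e j))"
      by metis
    show False
    proof (rule no_short_cycle[of n q L \<iota> "\<lambda>j w. f j ([], w)"])
      fix j w assume w: "j < n" "set w \<subseteq> {..<q}" "length w \<le> L" "w \<noteq> []" "hd w = \<iota> j"
      then have "([], w) \<in> D" "([], rotate1 w) \<in> D" by (auto simp: D_def coords_def)
      then show "f (Suc j) ([], w) = Suc (f j ([], rotate1 w)) mod Suc L"
        using e[OF w(1)] w(5) by (simp add: \<tau>_def tg(3) join_root D_def)
    qed (use e n f in auto)
  qed
  then obtain h where h: "inj_on h (\<tau> J ` V)" "\<And>a b. (a, b) \<in> R \<Longrightarrow> h a < (h b :: nat)"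
    using acyclic_injective_ranking[OF finV R_sub] by blast
  let ?f = "\<lambda>v. h (\<tau> J v)"
  have less: "?f (g e i) < ?f (t e)" if "e \<in> edges F" "i < q" for e i
    using that by (intro h(2)) (auto simp: R_def)
  have max: "Max (?f ` e) = ?f (t e)" if e: "e \<in> edges F" for e
  proof (rule Max_eqI)
    show "finite (?f ` e)" using sub[OF e] fin finite_subset by blast
    show "?f (t e) \<in> ?f ` e" using tg(1)[OF e] by blast
    fix y assume "y \<in> ?f ` e"
    then show "y \<le> ?f (t e)" using less[OF e] by (subst (asm) tg(1)[OF e]) (auto intro: less_imp_le)
  qed
  have mset: "label_mset ?f e = add_mset (?f (t e)) (image_mset (\<lambda>i. ?f (g e i)) (mset_set {..<q}))"
    if e: "e \<in> edges F" for e
  proof -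
    have notin: "t e \<notin> g e ` {..<q}" using less[OF e] by fastforce
    \<comment> \<open>As \<open>e\<close> has \<open>q + 1\<close> elements, the \<open>q\<close>
      children are distinct, and the multiset of labels has one entry per position.\<close>
    have "Suc q = Suc (card (g e ` {..<q}))"
      using tg(2)[OF e] by (subst (asm) tg(1)[OF e]) (simp add: notin)
    then have "inj_on (g e) {..<q}" by (intro eq_card_imp_inj_on) auto
    then have im: "image_mset (g e) (mset_set {..<q}) = mset_set (g e ` {..<q})"
      by (rule image_mset_mset_set)
    have "image_mset ?f (mset_set (g e ` {..<q})) = image_mset (\<lambda>i. ?f (g e i)) (mset_set {..<q})"
      by (simp add: multiset.map_comp comp_def flip: im)
    then show ?thesis unfolding label_mset_def by (subst tg(1)[OF e]) (simp add: notin)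
  qed
  have "layered_function F ?f"
    unfolding layered_function_def
  proof (intro conjI ballI impI)
    fix e assume e: "e \<in> edges F"
    show "\<exists>!v. v \<in> e \<and> ?f v = Max (?f ` e)"
    proof (rule ex1I[of _ "t e"])
      show "t e \<in> e \<and> ?f (t e) = Max (?f ` e)" using max[OF e] tg(1)[OF e] by auto
      fix v assume v: "v \<in> e \<and> ?f v = Max (?f ` e)"
      then have "v \<in> insert (t e) (g e ` {..<q})" using tg(1)[OF e] by simp
      then show "v = t e" using v max[OF e] less[OF e] by fastforce
    qed
  next
    fix e e' assume e: "e \<in> edges F" "e' \<in> edges F" "Max (?f ` e) = Max (?f ` e')"
    \<comment> \<open>Injectivity of \<open>h\<close> turns equal labels of tops into equal classes;
      \<open>children\<close> then matches the other labels position by position.\<close>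
    then have "\<tau> J (t e) = \<tau> J (t e')" using max tV h(1) by (auto dest: inj_onD)
    then show "label_mset ?f e = label_mset ?f e'"
      using e children[OF e(1,2)] by (auto simp: mset intro!: image_mset_cong)
  qed
  then show ?thesis by (auto simp: layered_def)
qed

section \<open>Host graphs and lower bounds on degrees\<close>

text \<open>The condition \<open>card e = Suc q\<close> forces \<open>t\<close> and the
  \<open>q\<close> values of \<open>g\<close> to be distinct.\<close>

definition host :: "nat \<Rightarrow> ('b \<Rightarrow> (nat \<Rightarrow> 'b) \<Rightarrow> bool) \<Rightarrow> (nat \<Rightarrow> 'b) \<Rightarrow> nat \<Rightarrow> nat hypergraph" where
  "host q P lab n = \<lparr>verts = {..<n}, edges = {e. e \<subseteq> {..<n} \<and> card e = Suc q \<and>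
     (\<exists>t g. e = insert t (g ` {..<q}) \<and> P (lab t) (\<lambda>i. lab (g i)))}\<rparr>"

lemma kgraph_host: "kgraph (Suc q) (host q P lab n)"
  by (auto simp: kgraph_def host_def)

lemma card_residue_class_ge:
  assumes "r < N"
  shows "n div N \<le> card {v. v < n \<and> v mod N = (r::nat)}"
proof -
  let ?g = "\<lambda>j. j * N + r"
  have "?g ` {..<n div N} \<subseteq> {v. v < n \<and> v mod N = r}"
  proof clarsimp
    fix j assume j: "j < n div N"
    then have "Suc j * N \<le> n div N * N" by (intro mult_le_mono1) simp
    also have "\<dots> \<le> n" by simp
    finally show "j * N + r < n \<and> r mod N = r" using assms by simp
  qed
  moreover have "inj_on ?g {..<n div N}" using assms by (auto simp: inj_on_def)
  ultimately show ?thesis using card_inj_on_le[of ?g "{..<n div N}"] by simp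
qed

text \<open>Enumerate \<open>T\<close> in any order as children. By \<open>ext\<close> a whole
  residue class can serve as top; at most \<open>q\<close> of its vertices lie in \<open>T\<close>,
  and the others give distinct edges.\<close>

lemma deg_host_ge:
  assumes T: "T \<subseteq> {..<n}" "card T = q" and N: "0 < N"
    and ext: "\<And>g. \<exists>r<N. \<forall>v. v mod N = r \<longrightarrow> P (lab v) (\<lambda>i. lab (g i))"
  shows "n div N - q \<le> deg (host q P lab n) T"
proof -
  have finT: "finite T" using T finite_subset by blast
  obtain g where "bij_betw g {..<q} T"
    using ex_bij_betw_nat_finite[OF finT] T by (auto simp: atLeast0LessThan)
  then have g: "g ` {..<q} = T" by (simp add: bij_betw_def)
  obtain r where r: "r < N" "\<And>v. v mod N = r \<Longrightarrow> P (lab v) (\<lambda>i. lab (g i))" using ext by blast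
  let ?A = "{v. v < n \<and> v mod N = r} - T" and ?B = "{e \<in> edges (host q P lab n). T \<subseteq> e}"
  have "(\<lambda>v. insert v T) ` ?A \<subseteq> ?B"
  proof (intro image_subsetI)
    fix v assume v: "v \<in> ?A"
    have "\<exists>t g. insert v T = insert t (g ` {..<q}) \<and> P (lab t) (\<lambda>i. lab (g i))"
      using r(2)[of v] v g by (intro exI[of _ v] exI[of _ g]) auto
    then show "insert v T \<in> ?B" using v T finT by (auto simp: host_def)
  qed
  moreover have "inj_on (\<lambda>v. insert v T) ?A" by (auto simp: inj_on_def)
  moreover have "finite ?B" by (rule finite_subset[of _ "Pow {..<n}"]) (auto simp: host_def)
  ultimately have "card ?A \<le> card ?B" by (intro card_inj_on_le)
  moreover have "card {v. v < n \<and> v mod N = r} - q \<le> card ?A"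
    using diff_card_le_card_Diff[OF finT] T(2) by simp
  ultimately show ?thesis using card_residue_class_ge[OF r(1), of n] by (simp add: deg_def)
qed

lemma card_supersets_ge:
  assumes V: "finite V" and S: "S \<subseteq> V" "card S = l" and "l \<le> q"
  shows "(card V - l) choose (q - l) \<le> card {T. S \<subseteq> T \<and> T \<subseteq> V \<and> card T = q}"
proof -
  have finS: "finite S" using assms finite_subset by blast
  let ?A = "{R. R \<subseteq> V - S \<and> card R = q - l}"
  have "card ?A = (card V - l) choose (q - l)"
    using n_subsets[of "V - S" "q - l"] V S finS by (simp add: card_Diff_subset)
  moreover have "card ?A \<le> card {T. S \<subseteq> T \<and> T \<subseteq> V \<and> card T = q}"
  proof (rule card_inj_on_le[of "\<lambda>R. S \<union> R"])
    show "inj_on (\<lambda>R. S \<union> R) ?A" by (auto simp: inj_on_def)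
    show "finite {T. S \<subseteq> T \<and> T \<subseteq> V \<and> card T = q}"
      by (rule finite_subset[of _ "Pow V"]) (use V in auto)
    show "(\<lambda>R. S \<union> R) ` ?A \<subseteq> {T. S \<subseteq> T \<and> T \<subseteq> V \<and> card T = q}"
    proof (intro image_subsetI)
      fix R assume R: "R \<in> ?A"
      then have "finite R" "S \<inter> R = {}" using V finite_subset by (blast, blast)
      then have "card (S \<union> R) = q" using R S finS \<open>l \<le> q\<close> by (simp add: card_Un_disjoint)
      then show "S \<union> R \<in> {T. S \<subseteq> T \<and> T \<subseteq> V \<and> card T = q}" using R S by auto
    qed
  qed
  ultimately show ?thesis by simp
qed

text \<open>Double counting of pairs \<open>(T, e)\<close> with
  \<open>S \<subseteq> T \<subseteq> e\<close> and \<open>card T = q\<close>: each \<open>T\<close>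
  lies in at least \<open>d\<close> edges, and each edge has only \<open>q + 1\<close> such
  subsets.\<close>

lemma deg_ge_codeg:
  assumes H: "kgraph (Suc q) H" and S: "S \<subseteq> verts H" "card S = l" "l \<le> q"
    and d: "\<And>T. T \<subseteq> verts H \<Longrightarrow> card T = q \<Longrightarrow> d \<le> deg H T"
  shows "((card (verts H) - l) choose (q - l)) * d \<le> deg H S * Suc q"
proof -
  have fin: "finite (verts H)" using H by (simp add: kgraph_def)
  let ?T = "{T. S \<subseteq> T \<and> T \<subseteq> verts H \<and> card T = q}" and ?E = "{e \<in> edges H. S \<subseteq> e}"
  have finT: "finite ?T" by (rule finite_subset[of _ "Pow (verts H)"]) (use fin in auto)
  have finE: "finite ?E"
    by (rule finite_subset[of _ "Pow (verts H)"]) (use fin H in \<open>auto simp: kgraph_def\<close>)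
  have "((card (verts H) - l) choose (q - l)) * d \<le> card ?T * d"
    using card_supersets_ge[OF fin S] by simp
  also have "\<dots> \<le> (\<Sum>T\<in>?T. deg H T)"
    using sum_bounded_below[of ?T d "deg H"] d by simp
  also have "\<dots> = (\<Sum>T\<in>?T. card {e \<in> ?E. T \<subseteq> e})"
    unfolding deg_def by (intro sum.cong refl arg_cong[of _ _ card]) auto
  also have "\<dots> = (\<Sum>e\<in>?E. card {T \<in> ?T. T \<subseteq> e})"
    by (rule sum_multicount_gen[OF finT finE]) simp
  also have "\<dots> \<le> (\<Sum>e\<in>?E. Suc q)"
  proof (rule sum_mono)
    fix e assume "e \<in> ?E"
    then have "e \<subseteq> verts H" and e: "card e = Suc q" using H by (auto simp: kgraph_def)
    then have fine: "finite e" using fin finite_subset by blast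
    have "card {T \<in> ?T. T \<subseteq> e} \<le> card {T. T \<subseteq> e \<and> card T = q}"
      by (rule card_mono) (use fine in auto)
    also have "\<dots> = Suc q" using n_subsets[OF fine, of q] e by simp
    finally show "card {T \<in> ?T. T \<subseteq> e} \<le> Suc q" .
  qed
  finally show ?thesis by (simp add: deg_def)
qed

section \<open>Turan numbers and free hosts of large minimum degree\<close>

text \<open>Infinitely many graphs compete, but their minimum degrees are at most
  \<open>2 ^ n\<close>, so \<open>Max\<close> ranges over a finite set. \<open>l \<le> n\<close>
  keeps \<open>Min\<close> off the empty set.\<close>

lemma min_deg_le_ex_deg:
  fixes F :: "'a hypergraph" and H :: "nat hypergraph"
  assumes "kgraph k H" "card (verts H) = n" "hfree F H" "l \<le> n"
  shows "min_deg l H \<le> ex_deg k l n F"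
proof -
  let ?A = "{min_deg l H | H :: nat hypergraph. kgraph k H \<and> card (verts H) = n \<and> hfree F H}"
  have "min_deg l G \<le> 2 ^ n" if G: "kgraph k G" "card (verts G) = n" for G :: "nat hypergraph"
  proof -
    have fin: "finite (verts G)" using G by (simp add: kgraph_def)
    obtain S where S: "S \<subseteq> verts G" "card S = l"
      using obtain_subset_with_card_n[of l "verts G"] G \<open>l \<le> n\<close> by metis
    have "finite {S. S \<subseteq> verts G \<and> card S = l}" using fin by simp
    then have "min_deg l G \<le> deg G S" unfolding min_deg_def using S by (intro Min_le) auto
    also have "\<dots> \<le> card (Pow (verts G))"
      unfolding deg_def using fin G by (intro card_mono) (auto simp: kgraph_def)
    finally show ?thesis using G by (simp add: card_Pow fin)
  qed
  then have "finite ?A" by (intro finite_subset[of ?A "{..2 ^ n}"]) auto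
  then show ?thesis unfolding ex_deg_def using assms by (intro Max_ge) auto
qed

lemma not_hfreeE:
  assumes "\<not> hfree F H"
  obtains \<phi> where "inj_on \<phi> (verts F)" "\<phi> ` verts F \<subseteq> verts H" "\<And>e. e \<in> edges F \<Longrightarrow> \<phi> ` e \<in> edges H"
proof -
  obtain G \<phi> where "subhypergraph G H" "bij_betw \<phi> (verts F) (verts G)"
    "edges G = (\<lambda>e. \<phi> ` e) ` edges F"
    using assms by (auto simp: hfree_def isomorphic_def)
  then show ?thesis by (intro that[of \<phi>]) (auto simp: subhypergraph_def bij_betw_def)
qed

text \<open>An embedding of \<open>F\<close> pulls the labelling back to \<open>F\<close>, where
  \<open>layered_if_typed\<close> applies.\<close>

lemma hfree_host:
  fixes F :: "'a hypergraph"
  assumes F: "kgraph (Suc q) F" and "\<not> layered F"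
    and L: "L = card (verts F) * card (verts F)"
  shows "hfree F (host q (\<lambda>y c. y = join q (card (verts F)) L c) lab n)" (is "hfree F ?H")
proof (rule ccontr)
  assume "\<not> hfree F ?H"
  then obtain \<phi> where \<phi>: "inj_on \<phi> (verts F)" "\<And>e. e \<in> edges F \<Longrightarrow> \<phi> ` e \<in> edges ?H"
    by (metis not_hfreeE)
  have "layered F"
  proof (rule layered_if_typed[where x = "\<lambda>v. lab (\<phi> v)" and q = q and L = L])
    show "finite (verts F)" "\<And>e. e \<in> edges F \<Longrightarrow> e \<subseteq> verts F"
      using F by (auto simp: kgraph_def)
    fix e assume e: "e \<in> edges F"
    then have eV: "e \<subseteq> verts F" "card e = Suc q" using F by (auto simp: kgraph_def)
    obtain t g where tg: "\<phi> ` e = insert t (g ` {..<q})"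
      "lab t = join q (card (verts F)) L (\<lambda>i. lab (g i))"
      using \<phi>(2)[OF e] by (auto simp: host_def)
    let ?\<psi> = "inv_into e \<phi>"
    have inj: "inj_on \<phi> e" using \<phi>(1) eV inj_on_subset by blast
    have retract: "\<phi> (?\<psi> y) = y" if "y \<in> insert t (g ` {..<q})" for y
      using that tg(1) by (metis f_inv_into_f)
    have "e = ?\<psi> ` \<phi> ` e" using inj by (simp add: inv_into_image_cancel)
    also have "\<dots> = insert (?\<psi> t) ((\<lambda>i. ?\<psi> (g i)) ` {..<q})" by (simp add: tg(1) image_image)
    finally have e_eq: "e = insert (?\<psi> t) ((\<lambda>i. ?\<psi> (g i)) ` {..<q})" .
    \<comment> \<open>Going to \<open>F\<close> and back fixes the children at positions below
      \<open>q\<close>, and \<open>join\<close> sees no others.\<close>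
    have "join q (card (verts F)) L (\<lambda>i. lab (g i))
        = join q (card (verts F)) L (\<lambda>i. lab (\<phi> (?\<psi> (g i))))"
      by (rule join_cong) (simp add: retract)
    then show "\<exists>t g. e = insert t (g ` {..<q}) \<and> card e = Suc q \<and>
        lab (\<phi> t) = join q (card (verts F)) L (\<lambda>i. lab (\<phi> (g i)))"
      using e_eq eV tg(2) retract[of t] by (intro exI[of _ "?\<psi> t"] exI[of _ "\<lambda>i. ?\<psi> (g i)"]) simp
  qed (rule L)
  then show False using assms by simp
qed

text \<open>The three factors in the denominator come from the binomial coefficient in
  \<open>deg_ge_codeg\<close>, from the bound \<open>n / (2 * N)\<close> on degrees of
  \<open>q\<close>-sets, and from the multiplicity \<open>q + 1\<close> in the double
  counting.\<close>

lemma min_deg_host_ge: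
  assumes l: "l \<le> q" "2 * Suc q * N \<le> n" and N: "0 < N"
    and ext: "\<And>g. \<exists>r<N. \<forall>v. v mod N = r \<longrightarrow> P (lab v) (\<lambda>i. lab (g i))"
  shows "1 / (real (2 * Suc q) ^ (q - l) * (2 * real N) * Suc q) * real n ^ (Suc q - l) \<le> min_deg l (host q P lab n)"
proof -
  let ?H = "host q P lab n"
  have V: "verts ?H = {..<n}" by (simp add: host_def)
  have "2 * Suc q * 1 \<le> 2 * Suc q * N" using N by (intro mult_le_mono2) simp
  then have n: "2 * Suc q \<le> n" using l(2) by linarith
  have bound: "1 / (real (2 * Suc q) ^ (q - l) * (2 * real N) * Suc q) * real n ^ (Suc q - l) \<le> deg ?H S"
    if S: "S \<subseteq> verts ?H" "card S = l" for S
  proof -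
    have "n div N - q \<le> deg ?H T" if "T \<subseteq> verts ?H" "card T = q" for T
      using that V by (intro deg_host_ge N ext) auto
    from deg_ge_codeg[OF kgraph_host S l(1) this]
    have "real (((n - l) choose (q - l)) * (n div N - q)) \<le> real (deg ?H S * Suc q)"
      unfolding of_nat_le_iff by (simp add: V)
    then have *: "real ((n - l) choose (q - l)) * real (n div N - q) \<le> real (deg ?H S) * Suc q"
      by (simp only: of_nat_mult)
    have "real n / (2 * Suc q) \<le> real (n - l) / (q - l)" if "0 < q - l"
    proof -
      have "n \<le> 2 * (n - l)" using n l(1) by simp
      then have "real n \<le> real (2 * (n - l))" by (simp only: of_nat_le_iff)
      then have "real n / 2 / Suc q \<le> real (n - l) / (q - l)"
        using that by (intro frac_le) auto
      then show ?thesis by (simp add: field_simps)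
    qed
    \<comment> \<open>For \<open>q - l = 0\<close> the right-hand quotient divides by zero, but both
      powers are then 1.\<close>
    then have "(real n / (2 * Suc q)) ^ (q - l) \<le> (real (n - l) / (q - l)) ^ (q - l)"
      by (cases "q - l = 0") (auto intro!: power_mono)
    also have "\<dots> \<le> real ((n - l) choose (q - l))"
      using n l(1) by (intro binomial_ge_n_over_k_pow_k) simp
    finally have c1: "(real n / (2 * Suc q)) ^ (q - l) \<le> real ((n - l) choose (q - l))" .
    \<comment> \<open>Half of \<open>n / N\<close> pays for the loss of \<open>q\<close> vertices in
      \<open>T\<close> and for rounding in \<open>n div N\<close>.\<close>
    have "real (Suc q * (2 * N)) \<le> real n" using l(2) by (simp only: of_nat_le_iff mult_ac)
    then have "Suc q \<le> real n / (2 * N)" using N by (simp add: pos_le_divide_eq algebra_simps)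
    then have "real n / (2 * N) + Suc q \<le> real n / N" by simp
    also have "\<dots> \<le> real (n div N) + 1"
      using floor_divide_of_nat_eq[of n N, where ?'a = real] by linarith
    finally have c2: "real n / (2 * N) \<le> real (n div N - q)" by simp
    have "(real n / (2 * Suc q)) ^ (q - l) * (real n / (2 * N)) \<le> real (deg ?H S) * Suc q"
      using mult_mono[OF c1 c2] * by simp
    moreover have "(real n / (2 * Suc q)) ^ (q - l) * (real n / (2 * N))
        = real n ^ (Suc q - l) / (real (2 * Suc q) ^ (q - l) * (2 * real N))"
      using l(1) by (simp add: power_divide Suc_diff_le)
    ultimately have "real n ^ (Suc q - l) / (real (2 * Suc q) ^ (q - l) * (2 * real N)) / Suc q
        \<le> real (deg ?H S)"
      by (simp only: pos_divide_le_eq of_nat_0_less_iff zero_less_Suc)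
    then show ?thesis by (simp only: divide_divide_eq_left times_divide_eq_left mult_1_left)
  qed
  have "l \<le> card (verts ?H)" using n l(1) by (simp add: V)
  then obtain S where S: "S \<subseteq> verts ?H" "card S = l" by (rule obtain_subset_with_card_n)
  have "finite {S. S \<subseteq> verts ?H \<and> card S = l}" by (simp add: V)
  then have "min_deg l ?H \<in> deg ?H ` {S. S \<subseteq> verts ?H \<and> card S = l}"
    unfolding min_deg_def using S by (intro Min_in) auto
  then show ?thesis using bound by auto
qed

section \<open>Nonvanishing of the density\<close>

lemma not_vanishing_if_ge:
  fixes a :: "nat \<Rightarrow> real"
  assumes "0 < c" and ge: "\<And>n. n0 \<le> n \<Longrightarrow> c * real n ^ r \<le> a n"
  shows "\<not> (\<lambda>n. a n / real (n choose r)) \<longlonglongrightarrow> 0"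
proof
  assume "(\<lambda>n. a n / real (n choose r)) \<longlonglongrightarrow> 0"
  moreover have "\<forall>\<^sub>F n in sequentially. c \<le> a n / real (n choose r)"
  proof (rule eventually_sequentiallyI)
    \<comment> \<open>\<open>r \<le> n\<close> makes the binomial coefficient positive, so the
      quotient is genuine.\<close>
    fix n assume n: "max n0 r \<le> n"
    have "real (n choose r) \<le> real n ^ r"
      using binomial_le_pow[of r n] n by (simp flip: of_nat_power)
    then have "c * real (n choose r) \<le> c * real n ^ r" using \<open>0 < c\<close> by simp
    also have "\<dots> \<le> a n" using ge n by simp
    finally show "c \<le> a n / real (n choose r)" using n by (simp add: field_simps)
  qed
  ultimately have "c \<le> 0" by (rule tendsto_lowerbound) simp
  then show False using \<open>0 < c\<close> by simp
qed

theorem corollary2: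
  fixes k l :: nat and F :: "'a hypergraph"
  assumes "3 \<le> k" and "1 \<le> l" and "l \<le> k - 1"
    and "kgraph k F"
    and "has_turan_density k l F 0"
  shows "layered F"
proof (rule ccontr)
  assume nl: "\<not> layered F"
  obtain q where q: "k = Suc q" using assms(1) by (cases k) auto
  define M where "M = card (verts F)"
  define L where "L = M * M"
  define X where "X = types q M L"
  define N where "N = card X"
  have N: "0 < N" unfolding N_def X_def by (simp add: card_gt_0_iff finite_types types_nonempty)
  obtain enc where enc: "bij_betw enc {..<N} X"
    using ex_bij_betw_nat_finite[of X] finite_types by (auto simp: N_def X_def atLeast0LessThan)
  \<comment> \<open>Each type thus occupies a full residue class modulo \<open>N\<close>.\<close>
  define lab where "lab v = enc (v mod N)" for v
  let ?H = "host q (\<lambda>y c. y = join q M L c) lab"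
  have lab: "lab v \<in> X" for v using enc N by (auto simp: lab_def bij_betw_def)
  have ext: "\<exists>r<N. \<forall>v. v mod N = r \<longrightarrow> lab v = join q M L (\<lambda>i. lab (g i))" for g
  proof -
    \<comment> \<open>Types are closed under \<open>join\<close>, so the type required of the top is
      carried by some residue class.\<close>
    have "join q M L (\<lambda>i. lab (g i)) \<in> X" using lab unfolding X_def by (intro join_in_types)
    then have "join q M L (\<lambda>i. lab (g i)) \<in> enc ` {..<N}" using enc by (simp add: bij_betw_def)
    then show ?thesis by (auto simp: lab_def)
  qed
  define c where "c = 1 / (real (2 * Suc q) ^ (q - l) * (2 * real N) * Suc q)"
  have "0 < c" using N by (simp add: c_def)
  have "c * real n ^ (k - l) \<le> real (ex_deg k l n F)" if n: "2 * Suc q * N \<le> n" for n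
  proof -
    have lq: "l \<le> q" using assms(3) q by simp
    have "Suc q * 1 \<le> Suc q * (2 * N)" using N by (intro mult_le_mono2) simp
    also have "\<dots> \<le> n" using n by (simp add: algebra_simps)
    finally have "l \<le> n" using lq by simp
    have "c * real n ^ (k - l) \<le> min_deg l (?H n)"
      using min_deg_host_ge[where P = "\<lambda>y c. y = join q M L c" and lab = lab, OF lq n N ext]
      by (simp only: c_def q)
    moreover have "min_deg l (?H n) \<le> ex_deg k l n F"
    proof (rule min_deg_le_ex_deg)
      show "kgraph k (?H n)" unfolding q by (rule kgraph_host)
      show "card (verts (?H n)) = n" by (simp add: host_def)
      show "hfree F (?H n)"
        using hfree_host assms(4) nl unfolding q M_def L_def by blast
    qed fact
    ultimately show ?thesis by simp
  qed
  from not_vanishing_if_ge[OF \<open>0 < c\<close> this] show False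
    using assms(5) by (simp add: has_turan_density_def)
qed

end
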